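(* Let $\mathbb C^+=\{\lambda\in\mathbb C:\mathrm{Re}(\lambda)>0\}$ and let $\mathcal P,\mathcal G\subseteq\mathcal H$ be two commuting subclasses of the class $\mathcal H$ of symmetric positive definite real $n\times n$ matrices (i.e. $\mathbf P\mathbf G=\mathbf G\mathbf P$ for all $\mathbf P\in\mathcal P$, $\mathbf G\in\mathcal G$). Then a real $n\times n$ matrix $\mathbf A$ is both multiplicative and additive $(\mathbb C^+,\mathcal G)$-stable if there exists a matrix $\mathbf P\in\mathcal P$ such that $$\mathbf W:=\mathbf P\mathbf A+\mathbf A^T\mathbf P$$ is positive definite.
   Context: $\sigma(\cdot)$ denotes the set of (complex) eigenvalues. A real $n\times n$ matrix $\mathbf A$ is multiplicative $(\mathbb C^+,\mathcal G)$-stable if $\sigma(\mathbf G\mathbf A)\subset\mathbb C^+$ and $\sigma(\mathbf A\mathbf G)\subset\mathbb C^+$ for every $\mathbf G\in\mathcal G$, and additive $(\mathbb C^+,\mathcal G)$-stable if $\sigma(\mathbf G+\mathbf A)\subset\mathbb C^+$ for every $\mathbf G\in\mathcal G$. *)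

theory Defs
  imports "Jordan_Normal_Form.Spectral_Radius"
begin

definition right_half_plane :: "complex set" where
  "right_half_plane = {z. Re z > 0}"

(* Symmetry is part of positive definiteness here. *)
definition pos_def_mats :: "nat \<Rightarrow> real mat set" where
  "pos_def_mats n = {H \<in> carrier_mat n n. transpose_mat H = H \<and>
     (\<forall>v \<in> carrier_vec n. v \<noteq> 0\<^sub>v n \<longrightarrow> scalar_prod v (H *\<^sub>v v) > 0)}"

(* The spectrum of a real matrix is taken over the complex numbers;
   applied to the real matrix itself, spectrum would yield only its real eigenvalues. *)
definition complex_spectrum :: "real mat \<Rightarrow> complex set" where
  "complex_spectrum A = spectrum (map_mat complex_of_real A)"

definition multiplicative_stable :: "complex set \<Rightarrow> real mat set \<Rightarrow> real mat \<Rightarrow> bool" where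
  "multiplicative_stable D \<G> A \<longleftrightarrow>
     (\<forall>G \<in> \<G>. complex_spectrum (G * A) \<subseteq> D \<and> complex_spectrum (A * G) \<subseteq> D)"

definition additive_stable :: "complex set \<Rightarrow> real mat set \<Rightarrow> real mat \<Rightarrow> bool" where
  "additive_stable D \<G> A \<longleftrightarrow> (\<forall>G \<in> \<G>. complex_spectrum (G + A) \<subseteq> D)"

end

theory Submission
  imports Defs
begin

text \<open>
  Let \<open>x\<close> be a complex eigenvector and write \<open>x*\<close> for its conjugate transpose.
  If \<open>A G x = \<lambda> x\<close> and \<open>y = G x\<close>, then \<open>y* P A y = \<lambda> x* G P x\<close>, and the real part
  of the left-hand side is \<open>y* W y / 2 > 0\<close>. If \<open>(G + A) x = \<lambda> x\<close>, then
  \<open>x* P G x + x* P A x = \<lambda> x* P x\<close>. In both cases \<open>Re \<lambda> > 0\<close> follows once the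
  product of the commuting matrices \<open>P\<close> and \<open>G\<close> is known to be positive semidefinite.

  For this last fact we use an argument of F. Riesz: after scaling to \<open>G \<le> I\<close>, the iteration
  \<open>B\<^sub>0 = G\<close>, \<open>B\<^sub>k\<^sub>+\<^sub>1 = B\<^sub>k - B\<^sub>k\<^sup>2\<close> keeps \<open>0 \<le> B\<^sub>k \<le> I\<close>, so that
  \<open>P G = (\<Sum>k<N. B\<^sub>k P B\<^sub>k) + P B\<^sub>N\<close> with \<open>B\<^sub>N v \<longlonglongrightarrow> 0\<close>. The eigenvectors are
  split into real and imaginary parts so that only real quadratic forms occur.
\<close>

section \<open>Real quadratic forms and the semidefinite class\<close>

definition pos_semidef_mats :: "nat \<Rightarrow> real mat set" where
  "pos_semidef_mats n = {H \<in> carrier_mat n n. transpose_mat H = H \<and>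
     (\<forall>v \<in> carrier_vec n. v \<bullet> (H *\<^sub>v v) \<ge> 0)}"

lemma symmetric_scalar_prod_swap:
  fixes H :: "real mat"
  assumes "H \<in> carrier_mat n n" "transpose_mat H = H" "u \<in> carrier_vec n" "v \<in> carrier_vec n"
  shows "u \<bullet> (H *\<^sub>v v) = (H *\<^sub>v u) \<bullet> v"
  using transpose_vec_mult_scalar[of H n n v u] assms by simp

text \<open>The matrices of the theorem are positive definite, but the Riesz iteration can leave
  that class: for \<open>n > 0\<close>, one step from the identity matrix gives the zero matrix. The
  iteration therefore runs in the weaker class.\<close>

lemma pos_def_subset_pos_semidef: "pos_def_mats n \<subseteq> pos_semidef_mats n"
proof
  fix H assume H: "H \<in> pos_def_mats n"
  then have Hc: "H \<in> carrier_mat n n" by (simp add: pos_def_mats_def)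
  have "v \<bullet> (H *\<^sub>v v) \<ge> 0" if v: "v \<in> carrier_vec n" for v
  proof (cases "v = 0\<^sub>v n")
    case True
    then show ?thesis using Hc by simp
  next
    case False
    then show ?thesis using H v by (simp add: pos_def_mats_def less_imp_le)
  qed
  then show "H \<in> pos_semidef_mats n"
    using H by (simp add: pos_def_mats_def pos_semidef_mats_def)
qed

lemma scalar_prod_self_nonneg: "(v :: real vec) \<bullet> v \<ge> 0"
  by (simp add: scalar_prod_def sum_nonneg)

lemma component_square_le_scalar_prod_self:
  fixes v :: "real vec"
  assumes "i < dim_vec v"
  shows "(v $ i)\<^sup>2 \<le> v \<bullet> v"
  unfolding scalar_prod_def power2_eq_square
  by (rule member_le_sum) (use assms in auto)

lemma quadratic_form_bounded:
  fixes H :: "real mat"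
  assumes H: "H \<in> carrier_mat n n"
  obtains c where "c > 0" "\<And>v. v \<in> carrier_vec n \<Longrightarrow> v \<bullet> (H *\<^sub>v v) \<le> c * (v \<bullet> v)"
proof
  \<comment> \<open>The summand 1 keeps \<open>c\<close> positive even for the zero matrix, so that
    \<open>c\<close> can serve as a divisor when scaling.\<close>
  define c where "c = 1 + (\<Sum>i<n. \<Sum>j<n. \<bar>H $$ (i,j)\<bar>)"
  show "c > 0" unfolding c_def by (smt (verit) sum_nonneg abs_ge_zero)
  fix v :: "real vec" assume v: "v \<in> carrier_vec n"
  have "v \<bullet> (H *\<^sub>v v) = (\<Sum>i<n. \<Sum>j<n. H $$ (i,j) * (v $ i * v $ j))"
    using H v by (auto simp: scalar_prod_def sum_distrib_left atLeast0LessThan intro!: sum.cong)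
  also have "\<dots> \<le> (\<Sum>i<n. \<Sum>j<n. \<bar>H $$ (i,j)\<bar> * (v \<bullet> v))"
  proof (intro sum_mono)
    fix i j assume "i \<in> {..<n}" "j \<in> {..<n}"
    then have ij: "(v $ i)\<^sup>2 \<le> v \<bullet> v" "(v $ j)\<^sup>2 \<le> v \<bullet> v"
      using v by (auto intro!: component_square_le_scalar_prod_self)
    \<comment> \<open>By the inequality of arithmetic and geometric means, with each of the two
      squares at most \<open>v \<bullet> v\<close>.\<close>
    have "\<bar>v $ i * v $ j\<bar> \<le> v \<bullet> v"
      using ij sum_squares_bound[of "\<bar>v $ i\<bar>" "\<bar>v $ j\<bar>"] by (simp add: abs_mult)
    then have "\<bar>H $$ (i,j)\<bar> * \<bar>v $ i * v $ j\<bar> \<le> \<bar>H $$ (i,j)\<bar> * (v \<bullet> v)"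
      by (rule mult_left_mono) simp
    then show "H $$ (i,j) * (v $ i * v $ j) \<le> \<bar>H $$ (i,j)\<bar> * (v \<bullet> v)"
      using abs_ge_self[of "H $$ (i,j) * (v $ i * v $ j)"] by (simp add: abs_mult)
  qed
  also have "\<dots> = (c - 1) * (v \<bullet> v)"
    by (simp add: c_def sum_distrib_right)
  also have "\<dots> \<le> c * (v \<bullet> v)"
    using scalar_prod_self_nonneg[of v] by (simp add: algebra_simps)
  finally show "v \<bullet> (H *\<^sub>v v) \<le> c * (v \<bullet> v)" .
qed

section \<open>The Riesz iteration and products of commuting semidefinite matrices\<close>

primrec riesz_seq :: "real mat \<Rightarrow> nat \<Rightarrow> real mat" where
  "riesz_seq B 0 = B"
| "riesz_seq B (Suc k) = riesz_seq B k - riesz_seq B k * riesz_seq B k"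

text \<open>Testing \<open>B\<close> on \<open>v - B v\<close> says that
  \<open>(I - B) B (I - B) = B - 2 B B + B B B\<close> is semidefinite. The bound
  \<open>B \<le> I\<close>, tested on \<open>B v\<close>, gives \<open>B B B \<le> B B\<close>, and
  the two add up to \<open>B B \<le> B\<close>.\<close>

lemma pos_semidef_le_one_square_le:
  assumes B: "B \<in> pos_semidef_mats n"
    and le: "\<And>v. v \<in> carrier_vec n \<Longrightarrow> v \<bullet> (B *\<^sub>v v) \<le> v \<bullet> v"
    and v: "v \<in> carrier_vec n"
  shows "(B *\<^sub>v v) \<bullet> (B *\<^sub>v v) \<le> v \<bullet> (B *\<^sub>v v)"
proof -
  have Bc: "B \<in> carrier_mat n n" and Bt: "transpose_mat B = B"
    using B by (auto simp: pos_semidef_mats_def)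
  define w where "w = B *\<^sub>v v"
  have w: "w \<in> carrier_vec n" and Bw: "B *\<^sub>v w \<in> carrier_vec n"
    using Bc v by (auto simp: w_def)
  have "0 \<le> (v - w) \<bullet> (B *\<^sub>v (v - w))"
    using B v w by (simp add: pos_semidef_mats_def)
  also have "B *\<^sub>v (v - w) = w - B *\<^sub>v w"
    using mult_minus_distrib_mat_vec[OF Bc v w] by (simp add: w_def)
  also have "(v - w) \<bullet> (w - B *\<^sub>v w) = v \<bullet> w - v \<bullet> (B *\<^sub>v w) - (w \<bullet> w - w \<bullet> (B *\<^sub>v w))"
    using v w Bw by (simp add: minus_scalar_prod_distrib[of _ n] scalar_prod_minus_distrib[of _ n])
  also have "v \<bullet> (B *\<^sub>v w) = w \<bullet> w"
    using symmetric_scalar_prod_swap[OF Bc Bt v w] by (simp add: w_def)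
  finally show ?thesis using le[OF w] by (simp add: w_def)
qed

text \<open>The lower bound for \<open>C - C * C\<close> is the preceding lemma. The upper bound
  survives because the form of \<open>C * C\<close> at \<open>v\<close> is the squared norm of
  \<open>C v\<close>, so each step only decreases the form.\<close>

lemma riesz_seq_invariant:
  assumes B: "B \<in> pos_semidef_mats n"
    and le: "\<And>v. v \<in> carrier_vec n \<Longrightarrow> v \<bullet> (B *\<^sub>v v) \<le> v \<bullet> v"
  shows "riesz_seq B k \<in> pos_semidef_mats n \<and>
    (\<forall>v \<in> carrier_vec n. v \<bullet> (riesz_seq B k *\<^sub>v v) \<le> v \<bullet> v)"
proof (induction k)
  case 0
  then show ?case using assms by simp
next
  case (Suc k)
  define C where "C = riesz_seq B k"
  have C: "C \<in> pos_semidef_mats n" and Cle: "\<And>v. v \<in> carrier_vec n \<Longrightarrow> v \<bullet> (C *\<^sub>v v) \<le> v \<bullet> v"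
    using Suc by (auto simp: C_def)
  have Cc: "C \<in> carrier_mat n n" and Ct: "transpose_mat C = C"
    using C by (auto simp: pos_semidef_mats_def)
  have form: "v \<bullet> ((C - C * C) *\<^sub>v v) = v \<bullet> (C *\<^sub>v v) - (C *\<^sub>v v) \<bullet> (C *\<^sub>v v)"
    if v: "v \<in> carrier_vec n" for v
    using Cc v symmetric_scalar_prod_swap[OF Cc Ct v, of "C *\<^sub>v v"]
    by (simp add: minus_mult_distrib_mat_vec[of _ n n] scalar_prod_minus_distrib[of _ n])
  have "transpose_mat (C - C * C) = C - C * C"
    using Cc Ct transpose_minus[of C n n "C * C"] transpose_mult[of C n n C n] by simp
  moreover have "0 \<le> v \<bullet> ((C - C * C) *\<^sub>v v)" if "v \<in> carrier_vec n" for v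
    using form[OF that] pos_semidef_le_one_square_le[OF C Cle that] by simp
  moreover have "v \<bullet> ((C - C * C) *\<^sub>v v) \<le> v \<bullet> v" if "v \<in> carrier_vec n" for v
    using form[OF that] Cle[OF that] scalar_prod_self_nonneg[of "C *\<^sub>v v"] by simp
  moreover have "C - C * C \<in> carrier_mat n n"
    using minus_carrier_mat[OF mult_carrier_mat[OF Cc Cc]] .
  ultimately show ?case
    by (simp add: C_def[symmetric] pos_semidef_mats_def)
qed

lemma riesz_seq_commute:
  assumes B: "B \<in> carrier_mat n n" and P: "P \<in> carrier_mat n n" and "P * B = B * P"
  shows "riesz_seq B k \<in> carrier_mat n n \<and> P * riesz_seq B k = riesz_seq B k * P"
proof (induction k)
  case 0
  then show ?case using assms by simp
next
  case (Suc k)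
  define C where "C = riesz_seq B k"
  have C: "C \<in> carrier_mat n n" and PC: "P * C = C * P"
    using Suc by (auto simp: C_def)
  have "P * (C * C) = C * C * P"
    by (metis C P PC assoc_mult_mat)
  then have "P * (C - C * C) = (C - C * C) * P"
    using C P PC mult_minus_distrib_mat[of P n n C n "C * C"] minus_mult_distrib_mat[of C n n "C * C" P n]
    by simp
  then show ?case
    using minus_carrier_mat[OF mult_carrier_mat[OF C C]] by (simp add: C_def[symmetric])
qed

text \<open>The limit is replaced by a contradiction. If the form is negative, the nonincreasing
  numbers \<open>u \<bullet> w k\<close> stay below a negative constant, which keeps
  \<open>w k\<close> away from zero; yet the squared norms of the \<open>w k\<close> have bounded
  partial sums.\<close>

lemma commuting_pos_semidef_le_one_form_nonneg:
  assumes B: "B \<in> pos_semidef_mats n" and P: "P \<in> pos_semidef_mats n"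
    and comm: "P * B = B * P"
    and le: "\<And>v. v \<in> carrier_vec n \<Longrightarrow> v \<bullet> (B *\<^sub>v v) \<le> v \<bullet> v"
    and v: "v \<in> carrier_vec n"
  shows "(P *\<^sub>v v) \<bullet> (B *\<^sub>v v) \<ge> 0"
proof (rule ccontr)
  assume neg: "\<not> ?thesis"
  have Bc: "B \<in> carrier_mat n n" and Pc: "P \<in> carrier_mat n n" and Pt: "transpose_mat P = P"
    using B P by (auto simp: pos_semidef_mats_def)
  define w where "w k = riesz_seq B k *\<^sub>v v" for k
  define u where "u = P *\<^sub>v v"
  have R: "riesz_seq B k \<in> carrier_mat n n" "P * riesz_seq B k = riesz_seq B k * P"
      "riesz_seq B k \<in> pos_semidef_mats n" "transpose_mat (riesz_seq B k) = riesz_seq B k" for k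
    using riesz_seq_commute[OF Bc Pc comm] riesz_seq_invariant[OF B le]
    by (auto simp: pos_semidef_mats_def)
  have w: "w k \<in> carrier_vec n" for k using R(1)[of k] v by (simp add: w_def)
  have u: "u \<in> carrier_vec n" using Pc v by (simp add: u_def)
  have w_Suc: "w (Suc k) = w k - riesz_seq B k *\<^sub>v w k" for k
    using R(1)[of k] v by (simp add: w_def minus_mult_distrib_mat_vec[of _ n n])
  have swap: "x \<bullet> (riesz_seq B k *\<^sub>v w k) = (riesz_seq B k *\<^sub>v x) \<bullet> w k" if "x \<in> carrier_vec n" for x k
    using symmetric_scalar_prod_swap[OF R(1) R(4) that w] .
  \<comment> \<open>Commutativity enters here. It turns the decrement of
    \<open>u \<bullet> w k\<close> in \<open>uw_step\<close> into the form of \<open>P\<close> at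
    \<open>w k\<close>.\<close>
  have Ru: "riesz_seq B k *\<^sub>v u = P *\<^sub>v w k" for k
    using R(1,2)[of k] Pc v assoc_mult_mat_vec[of P n n "riesz_seq B k" n v]
      assoc_mult_mat_vec[of "riesz_seq B k" n n P n v] by (simp add: u_def w_def)
  have vw_step: "v \<bullet> w (Suc k) = v \<bullet> w k - w k \<bullet> w k" for k
  proof -
    have "v \<bullet> w (Suc k) = v \<bullet> w k - v \<bullet> (riesz_seq B k *\<^sub>v w k)"
      unfolding w_Suc by (rule scalar_prod_minus_distrib) (use R(1)[of k] v w in auto)
    then show ?thesis using swap[OF v, of k] by (simp add: w_def)
  qed
  have uw_step: "u \<bullet> w (Suc k) \<le> u \<bullet> w k" for k
  proof -
    have "u \<bullet> w (Suc k) = u \<bullet> w k - u \<bullet> (riesz_seq B k *\<^sub>v w k)"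
      unfolding w_Suc by (rule scalar_prod_minus_distrib) (use R(1)[of k] u w in auto)
    also have "u \<bullet> (riesz_seq B k *\<^sub>v w k) = w k \<bullet> (P *\<^sub>v w k)"
      using swap[OF u, of k] Ru[of k] comm_scalar_prod[of "P *\<^sub>v w k" n "w k"] Pc w[of k] by simp
    finally show ?thesis using P w[of k] by (simp add: pos_semidef_mats_def)
  qed
  have uw: "u \<bullet> w k \<le> u \<bullet> w 0" for k
    by (induction k) (use uw_step order_trans in auto)
  have sum_w: "(\<Sum>k<N. w k \<bullet> w k) = v \<bullet> w 0 - v \<bullet> w N" for N
    by (induction N) (simp_all add: vw_step)
  define e where "e = - (u \<bullet> w 0)"
  have e: "e > 0" using neg by (simp add: e_def u_def w_def)
  \<comment> \<open>Chosen so that \<open>2 * t * e\<close> exceeds \<open>u \<bullet> u\<close> by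
    exactly 1; expanding the squared norm of \<open>u + t w k\<close> then bounds that of
    \<open>w k\<close> from below.\<close>
  define t where "t = (u \<bullet> u + 1) / (2 * e)"
  have t: "t > 0" "2 * t * e = u \<bullet> u + 1"
    using e scalar_prod_self_nonneg[of u] by (auto simp: t_def field_simps)
  have w_lower: "1 \<le> t\<^sup>2 * (w k \<bullet> w k)" for k
  proof -
    have "0 \<le> (u + t \<cdot>\<^sub>v w k) \<bullet> (u + t \<cdot>\<^sub>v w k)" by (rule scalar_prod_self_nonneg)
    also have "\<dots> = u \<bullet> u + 2 * t * (u \<bullet> w k) + t\<^sup>2 * (w k \<bullet> w k)"
      using u w[of k] comm_scalar_prod[OF u w[of k]]
      by (simp add: add_scalar_prod_distrib[of _ n] scalar_prod_add_distrib[of _ n] power2_eq_square algebra_simps)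
    also have "2 * t * (u \<bullet> w k) \<le> 2 * t * (- e)"
      using uw[of k] t(1) by (intro mult_left_mono) (auto simp: e_def)
    finally show ?thesis using t(2) by simp
  qed
  \<comment> \<open>The sum of the lower bounds grows like \<open>N\<close>, while the telescoped
    sum stays bounded because \<open>v \<bullet> w N\<close> is nonnegative.\<close>
  have bound: "real N \<le> t\<^sup>2 * (v \<bullet> w 0)" for N
  proof -
    have "real N = (\<Sum>k<N. 1)" by simp
    also have "\<dots> \<le> (\<Sum>k<N. t\<^sup>2 * (w k \<bullet> w k))" by (intro sum_mono w_lower)
    also have "\<dots> = t\<^sup>2 * (v \<bullet> w 0 - v \<bullet> w N)" by (simp add: sum_w sum_distrib_left[symmetric])
    also have "\<dots> \<le> t\<^sup>2 * (v \<bullet> w 0)"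
      using R(3)[of N] v by (intro mult_left_mono) (auto simp: pos_semidef_mats_def w_def)
    finally show ?thesis .
  qed
  obtain N where "t\<^sup>2 * (v \<bullet> w 0) < real N" using reals_Archimedean2 by blast
  then show False using bound[of N] by simp
qed

lemma smult_mat_mult_vec:
  fixes H :: "real mat"
  assumes "H \<in> carrier_mat n n" "v \<in> carrier_vec n"
  shows "(k \<cdot>\<^sub>m H) *\<^sub>v v = k \<cdot>\<^sub>v (H *\<^sub>v v)"
  using assms by (intro eq_vecI) auto

text \<open>Dividing \<open>G\<close> by a bound of its quadratic form reduces to the case
  \<open>G \<le> I\<close>; a positive factor changes neither commutation nor the sign.\<close>

lemma commuting_pos_semidef_form_nonneg:
  assumes G: "G \<in> pos_semidef_mats n" and P: "P \<in> pos_semidef_mats n"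
    and comm: "P * G = G * P" and v: "v \<in> carrier_vec n"
  shows "(P *\<^sub>v v) \<bullet> (G *\<^sub>v v) \<ge> 0"
proof -
  have Gc: "G \<in> carrier_mat n n" and Pc: "P \<in> carrier_mat n n" and Gt: "transpose_mat G = G"
    using G P by (auto simp: pos_semidef_mats_def)
  obtain c where c: "c > 0" and le: "\<And>v. v \<in> carrier_vec n \<Longrightarrow> v \<bullet> (G *\<^sub>v v) \<le> c * (v \<bullet> v)"
    using quadratic_form_bounded[OF Gc] by blast
  define B where "B = (1 / c) \<cdot>\<^sub>m G"
  have Bv: "B *\<^sub>v x = (1 / c) \<cdot>\<^sub>v (G *\<^sub>v x)" if "x \<in> carrier_vec n" for x
    unfolding B_def by (rule smult_mat_mult_vec[OF Gc that])
  have form: "y \<bullet> (B *\<^sub>v x) = y \<bullet> (G *\<^sub>v x) / c" if "x \<in> carrier_vec n" "y \<in> carrier_vec n" for x y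
    using that Gc by (simp add: Bv)
  have "transpose_mat B = B"
  proof (rule eq_matI)
    fix i j assume "i < dim_row B" "j < dim_col B"
    then show "transpose_mat B $$ (i, j) = B $$ (i, j)"
      using Gc arg_cong[OF Gt, of "\<lambda>M. M $$ (i, j)"] by (simp add: B_def)
  qed (use Gc in \<open>simp_all add: B_def\<close>)
  then have B: "B \<in> pos_semidef_mats n"
    using G Gc c form by (auto simp: pos_semidef_mats_def B_def)
  have "P * B = B * P"
    using Gc Pc comm by (simp add: B_def mult_smult_distrib mult_smult_assoc_mat)
  then have "(P *\<^sub>v v) \<bullet> (B *\<^sub>v v) \<ge> 0"
  proof (rule commuting_pos_semidef_le_one_form_nonneg[OF B P _ _ v])
    show "x \<bullet> (B *\<^sub>v x) \<le> x \<bullet> x" if "x \<in> carrier_vec n" for x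
      unfolding form[OF that that] using le[OF that] c by (simp add: divide_le_eq mult.commute)
  qed
  then show ?thesis using form[OF v, of "P *\<^sub>v v"] Pc v c by (simp add: zero_le_divide_iff)
qed

section \<open>The Lyapunov form and real coordinates of complex eigenvectors\<close>

lemma lyapunov_form_pos:
  assumes P: "P \<in> carrier_mat n n" "transpose_mat P = P" and A: "A \<in> carrier_mat n n"
    and W: "P * A + transpose_mat A * P \<in> pos_def_mats n"
    and v: "v \<in> carrier_vec n" "v \<noteq> 0\<^sub>v n"
  shows "(P *\<^sub>v v) \<bullet> (A *\<^sub>v v) > 0"
proof -
  have Av: "A *\<^sub>v v \<in> carrier_vec n" and Pv: "P *\<^sub>v v \<in> carrier_vec n" using A P v by auto
  have "0 < v \<bullet> ((P * A + transpose_mat A * P) *\<^sub>v v)"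
    using W v by (simp add: pos_def_mats_def)
  also have "(P * A + transpose_mat A * P) *\<^sub>v v = P *\<^sub>v (A *\<^sub>v v) + transpose_mat A *\<^sub>v (P *\<^sub>v v)"
    using A P v by (simp add: add_mult_distrib_mat_vec[of _ n n] assoc_mult_mat_vec[of _ n n _ n])
  also have "v \<bullet> \<dots> = v \<bullet> (P *\<^sub>v (A *\<^sub>v v)) + v \<bullet> (transpose_mat A *\<^sub>v (P *\<^sub>v v))"
    using A P v by (intro scalar_prod_add_distrib) auto
  also have "v \<bullet> (P *\<^sub>v (A *\<^sub>v v)) = (P *\<^sub>v v) \<bullet> (A *\<^sub>v v)"
    by (rule symmetric_scalar_prod_swap[OF P v(1) Av])
  \<comment> \<open>Both summands of \<open>W\<close> contribute the same number, so its form at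
    \<open>v\<close> is twice the form in question.\<close>
  also have "v \<bullet> (transpose_mat A *\<^sub>v (P *\<^sub>v v)) = (P *\<^sub>v v) \<bullet> (A *\<^sub>v v)"
    using transpose_vec_mult_scalar[OF A v(1) Pv] comm_scalar_prod[of v n "transpose_mat A *\<^sub>v (P *\<^sub>v v)"] A v Pv
    by simp
  finally show ?thesis by simp
qed

text \<open>For an eigenvector \<open>x = a + i b\<close>, these are the real and imaginary parts of
  \<open>M x = l x\<close>. Only one of \<open>a\<close>, \<open>b\<close> need be nonzero, since an
  eigenvector may be real or purely imaginary.\<close>

lemma complex_spectrum_real_parts:
  assumes M: "M \<in> carrier_mat n n" and l: "l \<in> complex_spectrum M"
  obtains a b where "a \<in> carrier_vec n" "b \<in> carrier_vec n" "a \<noteq> 0\<^sub>v n \<or> b \<noteq> 0\<^sub>v n"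
    "M *\<^sub>v a = Re l \<cdot>\<^sub>v a - Im l \<cdot>\<^sub>v b" "M *\<^sub>v b = Im l \<cdot>\<^sub>v a + Re l \<cdot>\<^sub>v b"
proof -
  obtain x where x: "x \<in> carrier_vec n" "x \<noteq> 0\<^sub>v n" "map_mat complex_of_real M *\<^sub>v x = l \<cdot>\<^sub>v x"
    using l M by (auto simp: complex_spectrum_def spectrum_def eigenvalue_def eigenvector_def)
  define a b where "a = map_vec Re x" and "b = map_vec Im x"
  have eig: "(\<Sum>j<n. complex_of_real (M $$ (i,j)) * x $ j) = l * x $ i" if "i < n" for i
    using arg_cong[OF x(3), of "\<lambda>y. y $ i"] that M x(1)
    by (auto simp: scalar_prod_def atLeast0LessThan)
  have re: "(\<Sum>j<n. M $$ (i,j) * Re (x $ j)) = Re l * Re (x $ i) - Im l * Im (x $ i)"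
    and im: "(\<Sum>j<n. M $$ (i,j) * Im (x $ j)) = Im l * Re (x $ i) + Re l * Im (x $ i)" if "i < n" for i
    using arg_cong[OF eig[OF that], of Re] arg_cong[OF eig[OF that], of Im] by auto
  show ?thesis
  proof
    show "a \<in> carrier_vec n" "b \<in> carrier_vec n" using x(1) by (auto simp: a_def b_def)
    show "a \<noteq> 0\<^sub>v n \<or> b \<noteq> 0\<^sub>v n"
    proof (rule ccontr)
      assume "\<not> ?thesis"
      then have "Re (x $ i) = 0 \<and> Im (x $ i) = 0" if "i < n" for i
        using that x(1) by (metis a_def b_def carrier_vecD index_map_vec(1) index_zero_vec(1))
      then have "x = 0\<^sub>v n" using x(1) by (intro eq_vecI) (auto simp: complex_eq_iff)
      then show False using x(2) by simp
    qed
    show "M *\<^sub>v a = Re l \<cdot>\<^sub>v a - Im l \<cdot>\<^sub>v b"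
      using M x(1) re by (intro eq_vecI) (auto simp: a_def b_def scalar_prod_def atLeast0LessThan)
    show "M *\<^sub>v b = Im l \<cdot>\<^sub>v a + Re l \<cdot>\<^sub>v b"
      using M x(1) im by (intro eq_vecI) (auto simp: a_def b_def scalar_prod_def atLeast0LessThan)
  qed
qed

section \<open>Spectra for a single commuting pair\<close>

locale lyapunov_pair =
  fixes n :: nat and P G A :: "real mat"
  assumes P: "P \<in> pos_def_mats n" and G: "G \<in> pos_def_mats n"
    and comm: "P * G = G * P" and A: "A \<in> carrier_mat n n"
    and W: "P * A + transpose_mat A * P \<in> pos_def_mats n"
begin

lemma carriers: "P \<in> carrier_mat n n" "G \<in> carrier_mat n n"
  and symmetric: "transpose_mat P = P" "transpose_mat G = G"
  using P G by (auto simp: pos_def_mats_def)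

lemma form_nonneg: "v \<in> carrier_vec n \<Longrightarrow> (P *\<^sub>v v) \<bullet> (G *\<^sub>v v) \<ge> 0"
  using commuting_pos_semidef_form_nonneg comm P G pos_def_subset_pos_semidef by blast

lemma form_pos: "v \<in> carrier_vec n \<Longrightarrow> v \<noteq> 0\<^sub>v n \<Longrightarrow> (P *\<^sub>v v) \<bullet> (A *\<^sub>v v) > 0"
  by (rule lyapunov_form_pos[OF carriers(1) symmetric(1) A W])

lemma form_A_nonneg: "v \<in> carrier_vec n \<Longrightarrow> (P *\<^sub>v v) \<bullet> (A *\<^sub>v v) \<ge> 0"
proof (cases "v = 0\<^sub>v n")
  case True
  then have "P *\<^sub>v v = 0\<^sub>v n" using carriers(1) by (intro eq_vecI) auto
  then show ?thesis using True A by simp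
qed (use form_pos[of v] in auto)

text \<open>This sum is the real part of \<open>x* P A x\<close> for
  \<open>x = a + i b\<close>.\<close>

lemma form_A_sum_pos:
  assumes "a \<in> carrier_vec n" "b \<in> carrier_vec n" "a \<noteq> 0\<^sub>v n \<or> b \<noteq> 0\<^sub>v n"
  shows "(P *\<^sub>v a) \<bullet> (A *\<^sub>v a) + (P *\<^sub>v b) \<bullet> (A *\<^sub>v b) > 0"
  using assms form_pos[of a] form_pos[of b] form_A_nonneg[of a] form_A_nonneg[of b] by force

text \<open>Needed to carry eigenvectors of \<open>G * A\<close> over to
  \<open>A * G\<close>.\<close>

lemma A_nonzero: "v \<in> carrier_vec n \<Longrightarrow> v \<noteq> 0\<^sub>v n \<Longrightarrow> A *\<^sub>v v \<noteq> 0\<^sub>v n"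
  using form_pos[of v] carriers by (metis less_irrefl mult_mat_vec_carrier scalar_prod_right_zero)

lemma G_nonzero: "v \<in> carrier_vec n \<Longrightarrow> v \<noteq> 0\<^sub>v n \<Longrightarrow> G *\<^sub>v v \<noteq> 0\<^sub>v n"
  using G unfolding pos_def_mats_def by (metis (mono_tags, lifting) less_irrefl mem_Collect_eq scalar_prod_right_zero)

text \<open>Both equations are paired with the images of \<open>G a\<close> and \<open>G b\<close>
  under \<open>P\<close>. Stating the result for vectors rather than for the spectrum lets
  \<open>complex_spectrum_GA\<close> apply it to \<open>A a\<close> and \<open>A b\<close>.\<close>

lemma AG_real_part_pos:
  assumes a: "a \<in> carrier_vec n" and b: "b \<in> carrier_vec n" and nz: "a \<noteq> 0\<^sub>v n \<or> b \<noteq> 0\<^sub>v n"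
    and ea: "A *\<^sub>v (G *\<^sub>v a) = r \<cdot>\<^sub>v a - s \<cdot>\<^sub>v b" and eb: "A *\<^sub>v (G *\<^sub>v b) = s \<cdot>\<^sub>v a + r \<cdot>\<^sub>v b"
  shows "r > 0"
proof -
  have Ga: "G *\<^sub>v a \<in> carrier_vec n" and Gb: "G *\<^sub>v b \<in> carrier_vec n" using carriers a b by auto
  have swap: "(P *\<^sub>v (G *\<^sub>v x)) \<bullet> y = (P *\<^sub>v x) \<bullet> (G *\<^sub>v y)"
    if x: "x \<in> carrier_vec n" and y: "y \<in> carrier_vec n" for x y
  proof -
    have "P *\<^sub>v (G *\<^sub>v x) = G *\<^sub>v (P *\<^sub>v x)"
      using carriers x comm by (metis assoc_mult_mat_vec)
    then show ?thesis
      using symmetric_scalar_prod_swap[OF carriers(2) symmetric(2) _ y, of "P *\<^sub>v x"] carriers x by simp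
  qed
  \<comment> \<open>The form of \<open>P G\<close> is symmetric, so the two terms with factor
    \<open>s\<close>, which have opposite signs, cancel.\<close>
  have cross: "(P *\<^sub>v a) \<bullet> (G *\<^sub>v b) = (P *\<^sub>v b) \<bullet> (G *\<^sub>v a)"
    using swap[OF a b] symmetric_scalar_prod_swap[OF carriers(1) symmetric(1) Ga b]
      comm_scalar_prod[of "G *\<^sub>v a" n "P *\<^sub>v b"] Ga carriers b by simp
  have "0 < (P *\<^sub>v (G *\<^sub>v a)) \<bullet> (A *\<^sub>v (G *\<^sub>v a)) + (P *\<^sub>v (G *\<^sub>v b)) \<bullet> (A *\<^sub>v (G *\<^sub>v b))"
    using form_A_sum_pos[OF Ga Gb] G_nonzero a b nz by blast
  also have "(P *\<^sub>v (G *\<^sub>v a)) \<bullet> (A *\<^sub>v (G *\<^sub>v a)) = r * ((P *\<^sub>v a) \<bullet> (G *\<^sub>v a)) - s * ((P *\<^sub>v a) \<bullet> (G *\<^sub>v b))"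
    unfolding ea using a b carriers Ga by (simp add: scalar_prod_minus_distrib[of _ n] swap)
  also have "(P *\<^sub>v (G *\<^sub>v b)) \<bullet> (A *\<^sub>v (G *\<^sub>v b)) = s * ((P *\<^sub>v b) \<bullet> (G *\<^sub>v a)) + r * ((P *\<^sub>v b) \<bullet> (G *\<^sub>v b))"
    unfolding eb using a b carriers Gb by (simp add: scalar_prod_add_distrib[of _ n] swap)
  finally have "0 < r * ((P *\<^sub>v a) \<bullet> (G *\<^sub>v a) + (P *\<^sub>v b) \<bullet> (G *\<^sub>v b))"
    using cross by (simp add: algebra_simps)
  \<comment> \<open>A positive product with one nonnegative factor has its other factor
    positive.\<close>
  then show ?thesis
    using form_nonneg[OF a] form_nonneg[OF b] by (simp add: zero_less_mult_iff)
qed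

lemma complex_spectrum_AG: "complex_spectrum (A * G) \<subseteq> right_half_plane"
proof
  fix l assume l: "l \<in> complex_spectrum (A * G)"
  have AG: "A * G \<in> carrier_mat n n" using A carriers by simp
  obtain a b where "a \<in> carrier_vec n" "b \<in> carrier_vec n" "a \<noteq> 0\<^sub>v n \<or> b \<noteq> 0\<^sub>v n"
    "(A * G) *\<^sub>v a = Re l \<cdot>\<^sub>v a - Im l \<cdot>\<^sub>v b" "(A * G) *\<^sub>v b = Im l \<cdot>\<^sub>v a + Re l \<cdot>\<^sub>v b"
    by (rule complex_spectrum_real_parts[OF AG l])
  then have "Re l > 0"
    using AG_real_part_pos[of a b "Re l" "Im l"] assoc_mult_mat_vec[OF A carriers(2)] by simp
  then show "l \<in> right_half_plane" by (simp add: right_half_plane_def)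
qed

text \<open>If \<open>x\<close> is an eigenvector of \<open>G A\<close>, then \<open>A x\<close> is one of \<open>A G\<close> for the same eigenvalue.\<close>

lemma complex_spectrum_GA: "complex_spectrum (G * A) \<subseteq> right_half_plane"
proof
  fix l assume l: "l \<in> complex_spectrum (G * A)"
  have GA: "G * A \<in> carrier_mat n n" using A carriers by simp
  obtain a b where ab: "a \<in> carrier_vec n" "b \<in> carrier_vec n" "a \<noteq> 0\<^sub>v n \<or> b \<noteq> 0\<^sub>v n"
    and e: "(G * A) *\<^sub>v a = Re l \<cdot>\<^sub>v a - Im l \<cdot>\<^sub>v b" "(G * A) *\<^sub>v b = Im l \<cdot>\<^sub>v a + Re l \<cdot>\<^sub>v b"
    by (rule complex_spectrum_real_parts[OF GA l])
  have e': "G *\<^sub>v (A *\<^sub>v a) = Re l \<cdot>\<^sub>v a - Im l \<cdot>\<^sub>v b" "G *\<^sub>v (A *\<^sub>v b) = Im l \<cdot>\<^sub>v a + Re l \<cdot>\<^sub>v b"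
    using e assoc_mult_mat_vec[OF carriers(2) A] ab by simp_all
  have "Re l > 0"
  proof (rule AG_real_part_pos)
    show "A *\<^sub>v a \<in> carrier_vec n" "A *\<^sub>v b \<in> carrier_vec n" using A ab by auto
    show "A *\<^sub>v a \<noteq> 0\<^sub>v n \<or> A *\<^sub>v b \<noteq> 0\<^sub>v n" using A_nonzero ab by blast
    show "A *\<^sub>v (G *\<^sub>v (A *\<^sub>v a)) = Re l \<cdot>\<^sub>v (A *\<^sub>v a) - Im l \<cdot>\<^sub>v (A *\<^sub>v b)"
      unfolding e' using A ab by (simp add: mult_minus_distrib_mat_vec[of _ n n] mult_mat_vec[of _ n n])
    show "A *\<^sub>v (G *\<^sub>v (A *\<^sub>v b)) = Im l \<cdot>\<^sub>v (A *\<^sub>v a) + Re l \<cdot>\<^sub>v (A *\<^sub>v b)"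
      unfolding e' using A ab by (simp add: mult_add_distrib_mat_vec[of _ n n] mult_mat_vec[of _ n n])
  qed
  then show "l \<in> right_half_plane" by (simp add: right_half_plane_def)
qed

text \<open>Pairing with \<open>P x\<close> splits the left side into a nonnegative part from
  \<open>G\<close> and a strictly positive part from \<open>A\<close>; the right side has real part
  \<open>Re l\<close> times \<open>x* P x\<close>.\<close>

lemma complex_spectrum_add: "complex_spectrum (G + A) \<subseteq> right_half_plane"
proof
  fix l assume l: "l \<in> complex_spectrum (G + A)"
  have GA: "G + A \<in> carrier_mat n n" using A carriers by simp
  obtain a b where a: "a \<in> carrier_vec n" and b: "b \<in> carrier_vec n" and nz: "a \<noteq> 0\<^sub>v n \<or> b \<noteq> 0\<^sub>v n"
    and ea: "(G + A) *\<^sub>v a = Re l \<cdot>\<^sub>v a - Im l \<cdot>\<^sub>v b" and eb: "(G + A) *\<^sub>v b = Im l \<cdot>\<^sub>v a + Re l \<cdot>\<^sub>v b"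
    by (rule complex_spectrum_real_parts[OF GA l])
  have expand: "(P *\<^sub>v x) \<bullet> ((G + A) *\<^sub>v x) = (P *\<^sub>v x) \<bullet> (G *\<^sub>v x) + (P *\<^sub>v x) \<bullet> (A *\<^sub>v x)"
    if "x \<in> carrier_vec n" for x
    using that A carriers by (simp add: add_mult_distrib_mat_vec[of _ n n] scalar_prod_add_distrib[of _ n])
  \<comment> \<open>Symmetry of \<open>P\<close> makes \<open>x* P x\<close> real and removes the
    terms with \<open>Im l\<close>.\<close>
  have cross: "(P *\<^sub>v a) \<bullet> b = (P *\<^sub>v b) \<bullet> a"
    using symmetric_scalar_prod_swap[OF carriers(1) symmetric(1) a b] comm_scalar_prod[OF a, of "P *\<^sub>v b"]
      carriers b by simp
  have Pform: "(P *\<^sub>v x) \<bullet> x \<ge> 0" if x: "x \<in> carrier_vec n" for x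
    unfolding symmetric_scalar_prod_swap[OF carriers(1) symmetric(1) x x, symmetric]
    using subsetD[OF pos_def_subset_pos_semidef P] x by (simp add: pos_semidef_mats_def)
  have "0 < (P *\<^sub>v a) \<bullet> ((G + A) *\<^sub>v a) + (P *\<^sub>v b) \<bullet> ((G + A) *\<^sub>v b)"
    using form_A_sum_pos[OF a b nz] form_nonneg[OF a] form_nonneg[OF b] expand[OF a] expand[OF b] by linarith
  also have "(P *\<^sub>v a) \<bullet> ((G + A) *\<^sub>v a) = Re l * ((P *\<^sub>v a) \<bullet> a) - Im l * ((P *\<^sub>v a) \<bullet> b)"
    unfolding ea using a b carriers by (simp add: scalar_prod_minus_distrib[of _ n])
  also have "(P *\<^sub>v b) \<bullet> ((G + A) *\<^sub>v b) = Im l * ((P *\<^sub>v b) \<bullet> a) + Re l * ((P *\<^sub>v b) \<bullet> b)"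
    unfolding eb using a b carriers by (simp add: scalar_prod_add_distrib[of _ n])
  finally have "0 < Re l * ((P *\<^sub>v a) \<bullet> a + (P *\<^sub>v b) \<bullet> b)"
    using cross by (simp add: algebra_simps)
  then have "Re l > 0"
    using Pform[OF a] Pform[OF b] by (simp add: zero_less_mult_iff)
  then show "l \<in> right_half_plane" by (simp add: right_half_plane_def)
qed

end

theorem theorem84:
  fixes n :: nat and \<P> \<G> :: "real mat set" and A :: "real mat"
  assumes "\<P> \<subseteq> pos_def_mats n"
    and "\<G> \<subseteq> pos_def_mats n"
    and "\<And>P G. P \<in> \<P> \<Longrightarrow> G \<in> \<G> \<Longrightarrow> P * G = G * P"
    and "A \<in> carrier_mat n n"
    and "\<exists>P \<in> \<P>. P * A + transpose_mat A * P \<in> pos_def_mats n"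
  shows "multiplicative_stable right_half_plane \<G> A \<and> additive_stable right_half_plane \<G> A"
proof -
  obtain P where P: "P \<in> \<P>" "P * A + transpose_mat A * P \<in> pos_def_mats n"
    using assms(5) by blast
  \<comment> \<open>The same witness \<open>P\<close> serves every \<open>G\<close>.\<close>
  have "lyapunov_pair n P G A" if "G \<in> \<G>" for G
    using assms P that by unfold_locales auto
  then show ?thesis
    unfolding multiplicative_stable_def additive_stable_def
    using lyapunov_pair.complex_spectrum_AG lyapunov_pair.complex_spectrum_GA
      lyapunov_pair.complex_spectrum_add by blast
qed

end
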